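(* Let $\mathbb{K}$ be a field of characteristic $0$. If a $4$-net $\lambda$ is embedded in $PG(2,\mathbb{K})$, then $-3$ is a square in $\mathbb{K}$ and the constant cross-ratio $\kappa$ of $\lambda$ satisfies $\kappa^2-\kappa+1=0$.
   Context: $PG(2,\mathbb{K})$ is the projective plane over the field $\mathbb{K}$. A $k$-net of order $n$ embedded in $PG(2,\mathbb{K})$ is a $k$-tuple $\lambda=(\lambda_1,\ldots,\lambda_k)$ of pairwise disjoint sets of lines of $PG(2,\mathbb{K})$ (called components), each of the same size $n$, such that any two lines from distinct components are concurrent with exactly one line from each component: if $\ell\in\lambda_i$, $m\in\lambda_j$ with $i\neq j$, then through the point $\ell\cap m$ there passes exactly one line of each of $\lambda_1,\ldots,\lambda_k$. The points of the net $\lambda$ are the $n^2$ points $\ell\cap m$ of this kind. Cross-ratio of four distinct concurrent lines $\ell_1,\ell_2,\ell_3,\ell_4$: choose linear forms $r,w$ such that $\ell_1,\ell_2,\ell_3$ have equations $r=0$, $w=0$, $r+w=0$; then $(\ell_1,\ell_2,\ell_3,\ell_4)$ is the unique $\kappa\in\mathbb{K}\setminus\{0,1\}$ such that $\ell_4$ has equation $\kappa r+w=0$. For a $4$-net $\lambda=(\lambda_1,\lambda_2,\lambda_3,\lambda_4)$ the cross-ratio $(\ell_1,\ell_2,\ell_3,\ell_4)$ of the four lines $\ell_i\in\lambda_i$ through a point $P$ of $\lambda$ does not depend on the choice of $P$; the common value $\kappa$ is called the constant cross-ratio of $\lambda$.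
   Formalization: The order n of the net is assumed to be at least 2: for n = 1 (four concurrent lines) the claim fails, e.g. over the rationals with cross-ratio 2, and for n = 0 there are no points and no cross-ratio. *)

theory Defs
  imports "HOL-Analysis.Analysis"
begin

text \<open>
  The projective plane over a field: its points and lines are the subspaces of dimension 1 and 2
  of the vector space of triples, and incidence is inclusion. For distinct lines \<open>l\<close> and \<open>m\<close>, the
  set \<open>l \<inter> m\<close> is a one-dimensional subspace, i.e. the point in which they meet.
\<close>

definition pg_lines :: "('a::field ^ 3) set set" where
  "pg_lines = {l. vec.subspace l \<and> vec.dim l = 2}"

text \<open>The components of a \<open>k\<close>-net are \<open>L 1, \<dots>, L k\<close>; other values of \<open>L\<close> are irrelevant.\<close>

definition is_net :: "nat \<Rightarrow> nat \<Rightarrow> (nat \<Rightarrow> ('a::field ^ 3) set set) \<Rightarrow> bool" where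
  "is_net k n L \<longleftrightarrow>
     (\<forall>i\<in>{1..k}. L i \<subseteq> pg_lines \<and> finite (L i) \<and> card (L i) = n) \<and>
     (\<forall>i\<in>{1..k}. \<forall>j\<in>{1..k}. i \<noteq> j \<longrightarrow> L i \<inter> L j = {}) \<and>
     (\<forall>i\<in>{1..k}. \<forall>j\<in>{1..k}. i \<noteq> j \<longrightarrow>
        (\<forall>l\<in>L i. \<forall>m\<in>L j. \<forall>h\<in>{1..k}. \<exists>!t. t \<in> L h \<and> l \<inter> m \<subseteq> t))"

definition net_points :: "nat \<Rightarrow> (nat \<Rightarrow> ('a::field ^ 3) set set) \<Rightarrow> ('a ^ 3) set set" where
  "net_points k L =
     {l \<inter> m | l m i j. i \<in> {1..k} \<and> j \<in> {1..k} \<and> i \<noteq> j \<and> l \<in> L i \<and> m \<in> L j}"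

definition linear_form :: "('a::field ^ 3 \<Rightarrow> 'a) \<Rightarrow> bool" where
  "linear_form r \<longleftrightarrow> Vector_Spaces.linear (*s) (*) r"

text \<open>
  For four distinct concurrent lines there is exactly one \<open>\<kappa>\<close> as below: the pair \<open>(r, w)\<close> is
  determined by the first three lines up to a common nonzero factor.
\<close>

definition cross_ratio ::
  "('a::field ^ 3) set \<Rightarrow> ('a ^ 3) set \<Rightarrow> ('a ^ 3) set \<Rightarrow> ('a ^ 3) set \<Rightarrow> 'a" where
  "cross_ratio l1 l2 l3 l4 =
     (THE \<kappa>. \<kappa> \<notin> {0, 1} \<and>
        (\<exists>r w. linear_form r \<and> linear_form w \<and>
           l1 = {x. r x = 0} \<and> l2 = {x. w x = 0} \<and>
           l3 = {x. r x + w x = 0} \<and> l4 = {x. \<kappa> * r x + w x = 0}))"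

text \<open>
  The common value of the cross-ratios at all points of a 4-net. The description operator yields
  an unspecified element if these cross-ratios are not all equal.
\<close>

definition constant_cross_ratio :: "(nat \<Rightarrow> ('a::field ^ 3) set set) \<Rightarrow> 'a" where
  "constant_cross_ratio L =
     (THE \<kappa>. \<forall>P\<in>net_points 4 L. \<forall>l1\<in>L 1. \<forall>l2\<in>L 2. \<forall>l3\<in>L 3. \<forall>l4\<in>L 4.
        P \<subseteq> l1 \<and> P \<subseteq> l2 \<and> P \<subseteq> l3 \<and> P \<subseteq> l4 \<longrightarrow> cross_ratio l1 l2 l3 l4 = \<kappa>)"

end

theory Submission
  imports Defs "HOL-Computational_Algebra.Fundamental_Theorem_Algebra"
begin

text \<open>
  Let \<open>F\<^sub>i\<close> be the product of linear forms of the lines of component \<open>i\<close>. Since \<open>F\<^sub>3\<close> and \<open>F\<^sub>4\<close> vanish at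
  the \<open>n\<^sup>2\<close> points of the net, \<open>F\<^sub>3 = a F\<^sub>1 + b F\<^sub>2\<close> and \<open>F\<^sub>4 = c F\<^sub>1 + d F\<^sub>2\<close>. The linear terms of these
  relations at a point of the net relate the four lines through it and show that their cross-ratio is
  \<open>\<kappa> = c b / (a d)\<close>. Multiplying, over all points, the ratios of the lines given by the linear
  terms, and comparing with the restrictions of the relations to the lines of components 1 and 2,
  gives \<open>\<kappa>\<close> to the power \<open>n\<^sup>2 - n\<close> equal to 1. Exchanging components 2 and 3 replaces \<open>\<kappa>\<close> by \<open>1 - \<kappa>\<close>,
  so both are roots of unity, which forces \<open>\<kappa>\<close> to be a primitive sixth root of unity. Then
  \<open>2 \<kappa> - 1\<close> is a square root of \<open>-3\<close>.
\<close>

section \<open>Linear forms and lines\<close>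

lemma linear_formI:
  assumes "\<And>x y. r (x + y) = r x + r y" "\<And>c x. r (c *s x) = c * r x"
  shows "linear_form r"
  unfolding linear_form_def by unfold_locales (use assms in \<open>auto simp: algebra_simps vec.scale_right_distrib\<close>)

lemma linear_form_add: "linear_form r \<Longrightarrow> r (x + y) = r x + r y"
  unfolding linear_form_def by (rule module_hom.add[OF Vector_Spaces.linear.axioms(3)])

lemma linear_form_scale: "linear_form r \<Longrightarrow> r (c *s x) = c * r x"
  unfolding linear_form_def by (rule module_hom.scale[OF Vector_Spaces.linear.axioms(3)])

lemma linear_form_diff: "linear_form r \<Longrightarrow> r (x - y) = r x - r y"
  unfolding linear_form_def by (rule module_hom.diff[OF Vector_Spaces.linear.axioms(3)])

lemmas linear_form_simps = linear_form_add linear_form_scale linear_form_diff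

lemma linear_form_combine:
  assumes "linear_form r" "linear_form w"
  shows "linear_form (\<lambda>x. a * r x + b * w x)"
  by (rule linear_formI) (use assms in \<open>auto simp: linear_form_simps algebra_simps\<close>)

lemma linear_form_mult: "linear_form r \<Longrightarrow> linear_form (\<lambda>x. a * r x)"
  by (rule linear_formI) (auto simp: linear_form_simps algebra_simps)

text \<open>Extend a basis of \<open>l\<close> by a vector \<open>x\<close> outside
  \<open>l\<close>. The form that is 1 at \<open>x\<close> and 0 on the basis has a proper subspace
  as kernel, so the dimension leaves no room between \<open>l\<close> and that kernel.\<close>

lemma pg_line_eq_kernel:
  fixes l :: "('a::field ^ 3) set"
  assumes "l \<in> pg_lines"
  shows "\<exists>r. linear_form r \<and> l = {x. r x = 0}"
proof -
  have sub: "vec.subspace l" and dim: "vec.dim l = 2"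
    using assms by (auto simp: pg_lines_def)
  have "vec.dim (UNIV :: ('a ^ 3) set) = 3"
    by (simp add: vec.dim_UNIV card_cart_basis)
  with dim obtain x where x: "x \<notin> l" by (metis UNIV_eq_I numeral_eq_iff semiring_norm(89))
  obtain B where B: "B \<subseteq> l" "vec.independent B" "l \<subseteq> vec.span B" "card B = vec.dim l"
    using vec.basis_exists by blast
  have spanB: "vec.span B = l"
    using B sub by (simp add: vec.span_subspace)
  have "vec.independent (insert x B)"
    using B(2) x spanB by (simp add: vec.independent_insertI)
  interpret form: vector_space_pair "(*s) :: 'a \<Rightarrow> 'a ^ 3 \<Rightarrow> 'a ^ 3" "(*) :: 'a \<Rightarrow> 'a \<Rightarrow> 'a" ..
  from form.linear_independent_extend[OF \<open>vec.independent (insert x B)\<close>, of "\<lambda>y. if y = x then 1 else 0"]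
  obtain r where r: "Vector_Spaces.linear (*s) (*) r" "\<forall>y\<in>insert x B. r y = (if y = x then 1 else 0)"
    by blast
  have lr: "linear_form r" using r(1) by (simp add: linear_form_def)
  let ?K = "{y. r y = 0}"
  have subK: "vec.subspace ?K"
    using linear_form_scale[OF lr, of 0 0] by (auto simp: vec.subspace_def linear_form_simps[OF lr])
  have "x \<notin> B" using B(1) x by blast
  hence "B \<subseteq> ?K" using r(2) by auto
  hence lK: "l \<subseteq> ?K" using spanB subK vec.span_minimal by blast
  have "x \<notin> ?K" using r(2) by simp
  hence "?K \<subset> UNIV" by blast
  hence "vec.dim ?K < 3"
    using vec.dim_psubset[of ?K UNIV] vec.span_eq_iff[THEN iffD2, OF subK]
      \<open>vec.dim (UNIV :: ('a ^ 3) set) = 3\<close> by (simp add: vec.span_UNIV)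
  hence "l = ?K"
    using vec.subspace_dim_equal[OF sub subK lK] dim by simp
  thus ?thesis using lr by blast
qed

lemma pg_lines_meet:
  fixes l m :: "('a::field ^ 3) set"
  assumes "l \<in> pg_lines" "m \<in> pg_lines"
  shows "\<exists>p. p \<noteq> 0 \<and> p \<in> l \<and> p \<in> m"
proof -
  have sub: "vec.subspace l" "vec.subspace m" and dim: "vec.dim l = 2" "vec.dim m = 2"
    using assms by (auto simp: pg_lines_def)
  have "vec.dim {x + y |x y. x \<in> l \<and> y \<in> m} \<le> 3"
    using vec.dim_subset_UNIV[of "{x + y |x y. x \<in> l \<and> y \<in> m}"] by (simp add: vec.dimension_def card_cart_basis)
  with vec.dim_sums_Int[OF sub] dim have "vec.dim (l \<inter> m) \<noteq> 0" by linarith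
  hence "\<not> l \<inter> m \<subseteq> {0}" by (simp add: vec.dim_eq_0)
  thus ?thesis by blast
qed

text \<open>Distinct planes in a 3-dimensional space meet in dimension at most 1, so
  \<open>l \<inter> m\<close> is the span of \<open>p\<close>. This lets a nonzero vector stand for
  a projective point.\<close>

lemma pg_lines_meet_unique:
  fixes l m :: "('a::field ^ 3) set"
  assumes "l \<in> pg_lines" "m \<in> pg_lines" "l \<noteq> m" "p \<in> l" "p \<in> m" "p \<noteq> 0"
    and "t \<in> pg_lines" "p \<in> t"
  shows "l \<inter> m \<subseteq> t"
proof -
  have sub: "vec.subspace l" "vec.subspace m" and dim: "vec.dim l = 2" "vec.dim m = 2"
    using assms by (auto simp: pg_lines_def)
  have subI: "vec.subspace (l \<inter> m)" using sub by (rule vec.subspace_inter)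
  have "vec.dim (l \<inter> m) \<noteq> 2"
  proof
    assume 2: "vec.dim (l \<inter> m) = 2"
    have "l \<inter> m = l" by (rule vec.subspace_dim_equal) (use sub subI dim 2 in auto)
    moreover have "l \<inter> m = m" by (rule vec.subspace_dim_equal) (use sub subI dim 2 in auto)
    ultimately show False using assms by blast
  qed
  moreover have "vec.dim (l \<inter> m) \<le> 2" using vec.dim_subset[of "l \<inter> m" l] dim by simp
  ultimately have "vec.dim (l \<inter> m) \<le> vec.dim (vec.span {p})" using assms by simp
  moreover have "vec.span {p} \<subseteq> l \<inter> m"
    using subI assms by (intro vec.span_minimal) auto
  ultimately have "vec.span {p} = l \<inter> m"
    using subI by (intro vec.subspace_dim_equal) auto
  moreover have "vec.span {p} \<subseteq> t"
    using assms by (intro vec.span_minimal) (auto simp: pg_lines_def)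
  ultimately show ?thesis by simp
qed

lemma exists_generic_vector:
  fixes S :: "('a::field_char_0 ^ 3 \<Rightarrow> 'a) set"
  assumes "finite S" "\<And>r. r \<in> S \<Longrightarrow> linear_form r" "\<And>r. r \<in> S \<Longrightarrow> \<exists>x. r x \<noteq> 0"
  shows "\<exists>v. \<forall>r\<in>S. r v \<noteq> 0"
  using assms
proof (induction S rule: finite_induct)
  case (insert r S)
  then obtain v where v: "\<forall>s\<in>S. s v \<noteq> 0" by auto
  obtain u where u: "r u \<noteq> 0" using insert.prems by blast
  \<comment> \<open>Move from \<open>v\<close> in the direction \<open>u\<close>: along
    \<open>v + x *s u\<close> every form is a nonzero polynomial in \<open>x\<close> of degree at
    most 1, because \<open>r u\<close> and all \<open>s v\<close> are nonzero. The infinite field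
    leaves a value of \<open>x\<close> that avoids all roots.\<close>
  let ?bad = "\<Union>s\<in>insert r S. {x. poly [:s v, s u:] x = 0}"
  have "finite ?bad"
    using insert.hyps v u by (intro finite_UN_I poly_roots_finite) auto
  then obtain x where "x \<notin> ?bad" using ex_new_if_finite[OF infinite_UNIV_char_0] by blast
  hence "\<forall>s\<in>insert r S. s (v + x *s u) \<noteq> 0"
    using insert.prems(1) by (auto simp: linear_form_simps)
  thus ?case by blast
qed auto

section \<open>Homogeneous functions vanishing on lines\<close>

text \<open>Homogeneous polynomials of degree \<open>n\<close> enter only through their restrictions to the parametrized
  lines \<open>p + x v\<close>, whose coefficient of \<open>x\<^sup>n\<close> is the value at \<open>v\<close>.\<close>

definition homogeneous_form :: "nat \<Rightarrow> ('a::field ^ 3 \<Rightarrow> 'a) \<Rightarrow> bool" where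
  "homogeneous_form n H \<longleftrightarrow>
     (\<forall>p v. \<exists>q. degree q \<le> n \<and> coeff q n = H v \<and> (\<forall>x. poly q x = H (p + x *s v)))"

lemma poly_prod_forms:
  assumes "\<And>l. l \<in> A \<Longrightarrow> linear_form (f l)"
  shows "poly (\<Prod>l\<in>A. [:f l p, f l v:]) x = (\<Prod>l\<in>A. f l (p + x *s v))"
  using assms by (auto simp: poly_prod linear_form_simps intro!: prod.cong)

lemma homogeneous_form_prod:
  fixes f :: "'l \<Rightarrow> 'a::field ^ 3 \<Rightarrow> 'a"
  assumes "finite A" "\<And>l. l \<in> A \<Longrightarrow> linear_form (f l)"
  shows "homogeneous_form (card A) (\<lambda>X. \<Prod>l\<in>A. f l X)"
  unfolding homogeneous_form_def
proof (intro allI exI conjI)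
  fix p v x
  let ?q = "\<Prod>l\<in>A. [:f l p, f l v:]"
  show "degree ?q \<le> card A" "coeff ?q (card A) = (\<Prod>l\<in>A. f l v)"
    using assms(1)
  proof (induction A rule: finite_induct)
    case (insert l A)
    { case 1
      have "degree ([:f l p, f l v:] * (\<Prod>l\<in>A. [:f l p, f l v:])) \<le> 1 + card A"
        using insert.IH(1) by (intro order.trans[OF degree_mult_le] add_mono) auto
      thus ?case using insert.hyps by simp
    }
    { case 2
      have "coeff (\<Prod>l\<in>A. [:f l p, f l v:]) (Suc (card A)) = 0"
        using insert.IH(1) by (intro coeff_eq_0) simp
      thus ?case using insert.hyps insert.IH(2) by simp
    }
  qed auto
  show "poly ?q x = (\<Prod>l\<in>A. f l (p + x *s v))" by (rule poly_prod_forms) (rule assms)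
qed

lemma homogeneous_form_diff_mult:
  assumes "homogeneous_form n F" "homogeneous_form n G"
  shows "homogeneous_form n (\<lambda>X. F X - c * G X)"
  unfolding homogeneous_form_def
proof (intro allI)
  fix p v
  obtain q q' where "degree q \<le> n \<and> coeff q n = F v \<and> (\<forall>x. poly q x = F (p + x *s v))"
    "degree q' \<le> n \<and> coeff q' n = G v \<and> (\<forall>x. poly q' x = G (p + x *s v))"
    using assms unfolding homogeneous_form_def by meson
  hence "degree (q - smult c q') \<le> n \<and> coeff (q - smult c q') n = F v - c * G v \<and>
    (\<forall>x. poly (q - smult c q') x = F (p + x *s v) - c * G (p + x *s v))"
    by (auto intro!: degree_diff_le order.trans[OF degree_smult_le])
  thus "\<exists>q. degree q \<le> n \<and> coeff q n = F v - c * G v \<and>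
    (\<forall>x. poly q x = F (p + x *s v) - c * G (p + x *s v))" by blast
qed

text \<open>The difference \<open>D\<close> of the two sides is normalized to vanish at a generic
  \<open>v0\<close>, so on each line of direction \<open>v0\<close> its degree is below
  \<open>card A\<close>. It also vanishes wherever that line meets a line of \<open>A\<close>; if
  these \<open>card A\<close> parameters are distinct, \<open>D\<close> is zero there. A second
  generic direction extends this to all vectors.\<close>

lemma homogeneous_form_eq_multiple:
  fixes f :: "'l \<Rightarrow> 'a::field_char_0 ^ 3 \<Rightarrow> 'a"
  assumes fin: "finite A" and lin: "\<And>l. l \<in> A \<Longrightarrow> linear_form (f l)"
    and nz: "\<And>l. l \<in> A \<Longrightarrow> \<exists>x. f l x \<noteq> 0"
    and indep: "\<And>l m. l \<in> A \<Longrightarrow> m \<in> A \<Longrightarrow> l \<noteq> m \<Longrightarrow> \<exists>x. f l x = 0 \<and> f m x \<noteq> 0"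
    and hom: "homogeneous_form (card A) H"
    and vanish: "\<And>l x. l \<in> A \<Longrightarrow> f l x = 0 \<Longrightarrow> H x = 0"
  shows "\<exists>c. \<forall>X. H X = c * (\<Prod>l\<in>A. f l X)"
proof -
  obtain v0 where v0: "\<And>l. l \<in> A \<Longrightarrow> f l v0 \<noteq> 0"
    using exists_generic_vector[of "f ` A"] fin lin nz by blast
  define c where "c = H v0 / (\<Prod>l\<in>A. f l v0)"
  define D where "D X = H X - c * (\<Prod>l\<in>A. f l X)" for X
  have homD: "homogeneous_form (card A) D"
    unfolding D_def by (intro homogeneous_form_diff_mult hom homogeneous_form_prod fin lin)
  have D0: "D v0 = 0" using v0 fin by (simp add: D_def c_def)
  have Dv: "D x = 0" if "l \<in> A" "f l x = 0" for l x
    using that vanish fin by (auto simp: D_def prod_zero)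
  \<comment> \<open>\<open>g (l, m)\<close> vanishes at \<open>X\<close> exactly if the line through
    \<open>X\<close> in direction \<open>v0\<close> meets \<open>l\<close> and \<open>m\<close> at
    the same parameter.\<close>
  define g where "g = (\<lambda>(l, m) X. f m v0 * f l X + (- f l v0) * f m X)"
  define I where "I = {(l, m). l \<in> A \<and> m \<in> A \<and> l \<noteq> m}"
  have finI: "finite I" by (rule finite_subset[of _ "A \<times> A"]) (use fin in \<open>auto simp: I_def\<close>)
  have ling: "linear_form (g i)" if "i \<in> I" for i
  proof -
    obtain l m where "i = (l, m)" "l \<in> A" "m \<in> A" using \<open>i \<in> I\<close> by (auto simp: I_def)
    thus ?thesis using linear_form_combine[OF lin lin, of l m "f m v0" "- f l v0"] by (simp add: g_def)
  qed
  have nzg: "\<exists>x. g i x \<noteq> 0" if "i \<in> I" for i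
  proof -
    obtain l m where lm: "i = (l, m)" "l \<in> A" "m \<in> A" "l \<noteq> m" using \<open>i \<in> I\<close> by (auto simp: I_def)
    then obtain x where "f l x = 0" "f m x \<noteq> 0" using indep by blast
    hence "g i x \<noteq> 0" using v0[of l] lm by (simp add: g_def)
    thus ?thesis by blast
  qed
  have generic: "D X = 0" if X: "\<And>i. i \<in> I \<Longrightarrow> g i X \<noteq> 0" for X
  proof -
    obtain q where q: "degree q \<le> card A" "coeff q (card A) = 0" "\<And>x. poly q x = D (X + x *s v0)"
      using homD D0 unfolding homogeneous_form_def by metis
    \<comment> \<open>The parameter at which \<open>X + x *s v0\<close> lies on
      \<open>l\<close>.\<close>
    define h where "h l = - f l X / f l v0" for l
    have "inj_on h A"
    proof (rule inj_onI, rule ccontr)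
      fix l m assume lm: "l \<in> A" "m \<in> A" "h l = h m" "l \<noteq> m"
      hence "g (l, m) X = 0" using v0 by (auto simp: h_def g_def field_simps)
      thus False using X[of "(l, m)"] lm by (auto simp: I_def)
    qed
    have "q = 0"
    proof (rule ccontr)
      assume "q \<noteq> 0"
      have "h ` A \<subseteq> {x. poly q x = 0}"
      proof (clarsimp simp: q(3))
        fix l assume "l \<in> A"
        thus "D (X + h l *s v0) = 0"
          using v0 lin by (intro Dv[of l]) (auto simp: linear_form_simps h_def)
      qed
      hence "card (h ` A) \<le> card {x. poly q x = 0}"
        by (intro card_mono poly_roots_finite \<open>q \<noteq> 0\<close>)
      hence "card A \<le> degree q"
        using card_poly_roots_bound[OF \<open>q \<noteq> 0\<close>] card_image[OF \<open>inj_on h A\<close>] by simp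
      hence "degree q = card A" using q(1) by simp
      thus False using q(2) \<open>q \<noteq> 0\<close> leading_coeff_0_iff by metis
    qed
    thus ?thesis using q(3)[of 0] by simp
  qed
  \<comment> \<open>The line from \<open>X\<close> in direction \<open>v\<close> leaves the generic
    set only finitely often, so \<open>D\<close> restricted to it has infinitely many zeros.\<close>
  have "D X = 0" for X
  proof -
    obtain v where v: "\<And>i. i \<in> I \<Longrightarrow> g i v \<noteq> 0"
      using exists_generic_vector[of "g ` I"] finI ling nzg by blast
    obtain q where q: "\<And>x. poly q x = D (X + x *s v)"
      using homD unfolding homogeneous_form_def by metis
    let ?bad = "\<Union>i\<in>I. {x. poly [:g i X, g i v:] x = 0}"
    have "finite ?bad" using finI v by (intro finite_UN_I poly_roots_finite) auto
    have "x \<in> ?bad \<or> poly q x = 0" for x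
      unfolding q using generic[of "X + x *s v"] ling by (auto simp: linear_form_simps)
    hence "UNIV \<subseteq> ?bad \<union> {x. poly q x = 0}" by auto
    hence "infinite (?bad \<union> {x. poly q x = 0})"
      using infinite_super[OF _ infinite_UNIV_char_0] by blast
    hence "infinite {x. poly q x = 0}" using \<open>finite ?bad\<close> by blast
    hence "q = 0" using poly_roots_finite by blast
    thus ?thesis using q[of 0] by simp
  qed
  hence "H X = c * (\<Prod>l\<in>A. f l X)" for X by (simp add: D_def)
  thus ?thesis by blast
qed

section \<open>Nets\<close>

text \<open>A line fixes its form only up to a nonzero factor. Other choices would rescale the
  pencil coefficients below, but not the ratio that becomes the cross-ratio.\<close>

definition line_form :: "('a::field ^ 3) set \<Rightarrow> 'a ^ 3 \<Rightarrow> 'a" where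
  "line_form l = (SOME r. linear_form r \<and> l = {x. r x = 0})"

lemma line_form:
  assumes "l \<in> pg_lines"
  shows "linear_form (line_form l)" and "x \<in> l \<longleftrightarrow> line_form l x = 0"
  using someI_ex[OF pg_line_eq_kernel[OF assms]] unfolding line_form_def by auto

lemma line_form_not_zero:
  assumes "l \<in> pg_lines"
  shows "\<exists>x. line_form l x \<noteq> 0"
proof (rule ccontr)
  assume "\<not> ?thesis"
  hence "l = UNIV" using line_form(2)[OF assms] by blast
  moreover have "vec.dim (UNIV :: ('a ^ 3) set) = 3"
    by (simp add: vec.dim_UNIV card_cart_basis)
  ultimately show False using assms by (simp add: pg_lines_def)
qed

lemma pg_lines_not_subset:
  assumes "l \<in> pg_lines" "m \<in> pg_lines" "l \<noteq> m"
  shows "\<exists>x. x \<in> l \<and> x \<notin> m"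
proof (rule ccontr)
  assume "\<not> ?thesis"
  hence "l \<subseteq> m" by blast
  hence "l = m" using assms by (intro vec.subspace_dim_equal) (auto simp: pg_lines_def)
  thus False using assms by blast
qed

text \<open>For \<open>n = 1\<close> any four distinct concurrent lines form a 4-net, with arbitrary
  cross-ratio. The bound on \<open>n\<close> gives every line a second line in its component and
  makes the exponent \<open>n * n - n\<close> positive.\<close>

locale embedded_net =
  fixes k n :: nat and L :: "nat \<Rightarrow> ('a::field_char_0 ^ 3) set set"
  assumes net: "is_net k n L" and order: "n \<ge> 2"
begin

definition component_form :: "nat \<Rightarrow> 'a ^ 3 \<Rightarrow> 'a" where
  "component_form i X = (\<Prod>l\<in>L i. line_form l X)"

text \<open>At a point of the net exactly one factor of the component form vanishes; this is the product of
  the other ones.\<close>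

definition cofactor :: "nat \<Rightarrow> 'a ^ 3 \<Rightarrow> 'a" where
  "cofactor i X = (\<Prod>l\<in>{l\<in>L i. line_form l X \<noteq> 0}. line_form l X)"

definition line_through :: "nat \<Rightarrow> 'a ^ 3 \<Rightarrow> ('a ^ 3) set" where
  "line_through i p = (THE l. l \<in> L i \<and> p \<in> l)"

lemma finite_component: "i \<in> {1..k} \<Longrightarrow> finite (L i)"
  and card_component: "i \<in> {1..k} \<Longrightarrow> card (L i) = n"
  and component_line: "i \<in> {1..k} \<Longrightarrow> l \<in> L i \<Longrightarrow> l \<in> pg_lines"
  using net by (auto simp: is_net_def)

lemma component_lines_distinct:
  "i \<in> {1..k} \<Longrightarrow> j \<in> {1..k} \<Longrightarrow> i \<noteq> j \<Longrightarrow> l \<in> L i \<Longrightarrow> m \<in> L j \<Longrightarrow> l \<noteq> m"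
  using net unfolding is_net_def by blast

lemma cofactor_nonzero: "i \<in> {1..k} \<Longrightarrow> cofactor i p \<noteq> 0"
  using finite_component by (simp add: cofactor_def)

section \<open>Vectors representing points on and off the net\<close>

text \<open>Translates the net axiom to vectors: since \<open>p\<close> spans
  \<open>l \<inter> m\<close>, a line contains this intersection exactly if it contains
  \<open>p\<close>.\<close>

lemma unique_line_through:
  assumes "i \<in> {1..k}" "j \<in> {1..k}" "i \<noteq> j" "l \<in> L i" "m \<in> L j" "p \<in> l" "p \<in> m" "p \<noteq> 0"
    and h: "h \<in> {1..k}"
  shows "\<exists>!t. t \<in> L h \<and> p \<in> t"
proof -
  have lm: "l \<in> pg_lines" "m \<in> pg_lines" "l \<noteq> m"
    using assms component_line component_lines_distinct by blast+
  have "t \<in> L h \<and> l \<inter> m \<subseteq> t \<longleftrightarrow> t \<in> L h \<and> p \<in> t" for t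
    using pg_lines_meet_unique[OF lm assms(6,7,8), of t] assms(6,7) component_line[OF h] by auto
  moreover have "\<exists>!t. t \<in> L h \<and> l \<inter> m \<subseteq> t"
    using assms by (intro net[unfolded is_net_def, THEN conjunct2, THEN conjunct2, rule_format])
  ultimately show ?thesis by simp
qed

lemma line_through:
  assumes "i \<in> {1..k}" "j \<in> {1..k}" "i \<noteq> j" "l \<in> L i" "m \<in> L j" "p \<in> l" "p \<in> m" "p \<noteq> 0"
    and "h \<in> {1..k}"
  shows "line_through h p \<in> L h" "p \<in> line_through h p"
    and "t \<in> L h \<Longrightarrow> p \<in> t \<Longrightarrow> line_through h p = t"
proof -
  note unique = unique_line_through[OF assms]
  show mem: "line_through h p \<in> L h" "p \<in> line_through h p"
    using theI'[OF unique] by (auto simp: line_through_def)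
  show "line_through h p = t" if "t \<in> L h" "p \<in> t"
    using unique mem that by blast
qed

text \<open>Otherwise a line of component \<open>h\<close> through \<open>p\<close> would make
  \<open>p\<close> a point of the net, through which \<open>l\<close> and \<open>m\<close> could not
  both pass.\<close>

lemma component_form_nonzero:
  assumes "i \<in> {1..k}" "h \<in> {1..k}" "h \<noteq> i" "l \<in> L i" "m \<in> L i" "l \<noteq> m" "p \<in> l" "p \<in> m" "p \<noteq> 0"
  shows "component_form h p \<noteq> 0"
proof
  assume "component_form h p = 0"
  then obtain t where t: "t \<in> L h" "p \<in> t"
    using finite_component[OF assms(2)] line_form(2)[OF component_line[OF assms(2)]]
    by (auto simp: component_form_def)
  show False
    using unique_line_through[OF assms(1,2) _ assms(4) t(1) assms(7) t(2) assms(9,1)] assms by auto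
qed

lemma component_form_zero:
  assumes "i \<in> {1..k}" "l \<in> L i" "p \<in> l"
  shows "component_form i p = 0"
proof -
  have "line_form l p = 0" using line_form(2)[OF component_line[OF assms(1,2)]] assms(3) by blast
  thus ?thesis
    using assms(2) unfolding component_form_def by (intro prod_zero finite_component assms(1)) blast
qed

lemma exists_non_net_point:
  assumes "i \<in> {1..k}" "l \<in> L i"
  obtains p where "p \<in> l" "component_form i p = 0" "\<And>h. h \<in> {1..k} \<Longrightarrow> h \<noteq> i \<Longrightarrow> component_form h p \<noteq> 0"
proof -
  have "L i \<noteq> {l}" using card_component[OF assms(1)] order by auto
  then obtain m where m: "m \<in> L i" "m \<noteq> l" using assms by blast
  obtain p where p: "p \<noteq> 0" "p \<in> l" "p \<in> m"
    using pg_lines_meet component_line assms m by metis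
  show ?thesis
    using that[OF p(2)] component_form_zero[OF assms p(2)]
      component_form_nonzero[OF assms(1) _ _ assms(2) m(1) _ p(2,3,1)] m(2) by metis
qed

section \<open>Restriction of component forms to a line of the net\<close>

text \<open>A line of component \<open>h\<close> meets \<open>l\<close> in a single point. If it
  belongs to both \<open>m\<close> and \<open>m'\<close>, these pass through the same point of the
  net and coincide. Equal cardinalities turn injectivity into bijectivity.\<close>

lemma bij_betw_line_through:
  assumes "i \<in> {1..k}" "j \<in> {1..k}" "h \<in> {1..k}" "i \<noteq> j" "i \<noteq> h" and l: "l \<in> L i"
    and q: "\<And>m. m \<in> L j \<Longrightarrow> q m \<in> l \<and> q m \<in> m \<and> q m \<noteq> 0"
  shows "bij_betw (\<lambda>m. line_through h (q m)) (L j) (L h)"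
proof -
  have lt: "line_through h (q m) \<in> L h" "q m \<in> line_through h (q m)" if "m \<in> L j" for m
    using line_through(1,2)[OF assms(1,2,4) l that _ _ _ assms(3)] q[OF that] by simp_all
  have "inj_on (\<lambda>m. line_through h (q m)) (L j)"
  proof (rule inj_onI)
    fix m m' assume m: "m \<in> L j" "m' \<in> L j" "line_through h (q m) = line_through h (q m')"
    let ?t = "line_through h (q m)"
    have "?t \<in> pg_lines" "l \<in> pg_lines" "m' \<in> pg_lines" "l \<noteq> ?t"
      using lt(1)[OF m(1)] m(2) l component_line assms(1-3) component_lines_distinct[OF assms(1,3,5)] by auto
    hence "l \<inter> ?t \<subseteq> m'" 
      using pg_lines_meet_unique[of l ?t "q m'" m'] lt[OF m(2)] q[OF m(2)] m(3) by simp
    hence "q m \<in> m'" using lt[OF m(1)] q[OF m(1)] by blast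
    thus "m = m'"
      using unique_line_through[OF assms(1,2,4) l m(1) _ _ _ assms(2), of "q m"] q[OF m(1)] m(1,2) by auto
  qed
  moreover have "(\<lambda>m. line_through h (q m)) ` L j \<subseteq> L h" using lt by blast
  ultimately have "(\<lambda>m. line_through h (q m)) ` L j = L h"
    using assms by (intro card_subset_eq) (auto simp: finite_component card_component card_image)
  with \<open>inj_on _ _\<close> show ?thesis by (simp add: bij_betw_def)
qed

text \<open>On \<open>l\<close>, the forms of \<open>m\<close> and of the line of component
  \<open>h\<close> through \<open>q m\<close> both vanish at \<open>q m\<close>, so the second is a
  multiple of the first. The bijection lets these relations be multiplied over all of
  \<open>L j\<close>.\<close>

lemma proportional_on_line:
  assumes "i \<in> {1..k}" "j \<in> {1..k}" "h \<in> {1..k}" "i \<noteq> j" "i \<noteq> h" and l: "l \<in> L i"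
  shows "\<exists>c. \<forall>X\<in>l. component_form h X = c * component_form j X"
proof -
  have "\<exists>p. p \<in> l \<and> p \<in> m \<and> p \<noteq> 0" if "m \<in> L j" for m
    using pg_lines_meet component_line assms that by metis
  then obtain q where q: "\<And>m. m \<in> L j \<Longrightarrow> q m \<in> l \<and> q m \<in> m \<and> q m \<noteq> 0" by metis
  let ?s = "\<lambda>m. line_through h (q m)"
  have bij: "bij_betw ?s (L j) (L h)"
    using bij_betw_line_through[OF assms q] .
  have "\<exists>c. \<forall>X\<in>l. line_form (?s m) X = c * line_form m X" if m: "m \<in> L j" for m
  proof -
    have t: "?s m \<in> L h" "q m \<in> ?s m"
      using line_through(1,2)[OF assms(1,2,4) l m _ _ _ assms(3)] q[OF m] by simp_all
    have lines: "l \<in> pg_lines" "m \<in> pg_lines" "?s m \<in> pg_lines" "l \<noteq> m"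
      using l m t component_line assms(1-3) component_lines_distinct[OF assms(1,2,4) l m] by auto
    obtain u where u: "u \<in> l" "u \<notin> m" using pg_lines_not_subset[OF lines(1,2,4)] by blast
    have sub: "l \<inter> m \<subseteq> ?s m" 
      using pg_lines_meet_unique[OF lines(1,2,4) _ _ _ lines(3)] q[OF m] t(2) by blast
    show ?thesis
    proof (intro exI ballI)
      fix X assume "X \<in> l"
      \<comment> \<open>The projection of \<open>X\<close> to \<open>m\<close> along
        \<open>u\<close>. It stays in \<open>l\<close>, hence lies in \<open>l \<inter> m\<close>,
        where the form of \<open>?s m\<close> vanishes.\<close>
      let ?Y = "X - (line_form m X / line_form m u) *s u"
      have "?Y \<in> m" using u lines by (simp add: line_form linear_form_diff linear_form_scale)
      moreover have "?Y \<in> l" using \<open>X \<in> l\<close> u lines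
        by (auto simp: pg_lines_def intro!: vec.subspace_diff vec.subspace_scale)
      ultimately have "line_form (?s m) ?Y = 0" using sub line_form(2)[OF lines(3)] by blast
      thus "line_form (?s m) X = line_form (?s m) u / line_form m u * line_form m X"
        using lines by (simp add: line_form linear_form_diff linear_form_scale)
    qed
  qed
  then obtain c where c: "\<And>m X. m \<in> L j \<Longrightarrow> X \<in> l \<Longrightarrow> line_form (?s m) X = c m * line_form m X"
    by metis
  have "component_form h X = (\<Prod>m\<in>L j. c m) * component_form j X" if "X \<in> l" for X
  proof -
    have "component_form h X = (\<Prod>m\<in>L j. line_form (?s m) X)"
      unfolding component_form_def by (rule prod.reindex_bij_betw[OF bij, symmetric])
    thus ?thesis using that c by (simp add: component_form_def prod.distrib)
  qed
  thus ?thesis by blast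
qed

text \<open>The proportionality factors agree at the intersection of two lines of component \<open>i\<close>, where no
  other component form vanishes.\<close>

lemma proportional_on_component:
  assumes "i \<in> {1..k}" "j \<in> {1..k}" "h \<in> {1..k}" "i \<noteq> j" "i \<noteq> h"
  shows "\<exists>c. \<forall>l\<in>L i. \<forall>X\<in>l. component_form h X = c * component_form j X"
proof -
  obtain c where c: "\<And>l X. l \<in> L i \<Longrightarrow> X \<in> l \<Longrightarrow> component_form h X = c l * component_form j X"
    using proportional_on_line[OF assms] by metis
  have "c l = c m" if lm: "l \<in> L i" "m \<in> L i" for l m
  proof (cases "l = m")
    case False
    obtain p where p: "p \<noteq> 0" "p \<in> l" "p \<in> m"
      using pg_lines_meet component_line assms lm by metis
    have "component_form j p \<noteq> 0"
      using component_form_nonzero[OF assms(1,2) _ lm False p(2,3,1)] assms(4) by simp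
    thus ?thesis using c[OF lm(1) p(2)] c[OF lm(2) p(3)] by simp
  qed simp
  thus ?thesis using c by metis
qed

lemma homogeneous_component_form:
  assumes "i \<in> {1..k}"
  shows "homogeneous_form n (component_form i)"
proof -
  have "homogeneous_form (card (L i)) (\<lambda>X. \<Prod>l\<in>L i. line_form l X)"
    using assms by (intro homogeneous_form_prod finite_component line_form(1) component_line)
  thus ?thesis using assms unfolding component_form_def[abs_def] by (simp add: card_component)
qed

text \<open>By \<open>proportional_on_component\<close>,
  \<open>component_form h - b * component_form j\<close> vanishes on every line of component
  \<open>i\<close> for a single \<open>b\<close>, so it is a multiple of
  \<open>component_form i\<close>.\<close>

lemma component_form_pencil:
  assumes "i \<in> {1..k}" "j \<in> {1..k}" "h \<in> {1..k}" "i \<noteq> j" "i \<noteq> h" "j \<noteq> h"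
  shows "\<exists>a b. a \<noteq> 0 \<and> b \<noteq> 0 \<and>
    (\<forall>X. component_form h X = a * component_form i X + b * component_form j X)"
proof -
  obtain b where b: "\<And>l X. l \<in> L i \<Longrightarrow> X \<in> l \<Longrightarrow> component_form h X = b * component_form j X"
    using proportional_on_component assms by metis
  let ?H = "\<lambda>X. component_form h X - b * component_form j X"
  have "\<exists>c. \<forall>X. ?H X = c * (\<Prod>l\<in>L i. line_form l X)"
  proof (rule homogeneous_form_eq_multiple)
    show "finite (L i)" using assms finite_component by blast
    show "homogeneous_form (card (L i)) ?H"
      using assms by (simp add: card_component homogeneous_form_diff_mult homogeneous_component_form)
    show "?H x = 0" if "l \<in> L i" "line_form l x = 0" for l x
      using that b[of l x] line_form(2)[OF component_line[OF assms(1)]] by simp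
    show "\<exists>x. line_form l x = 0 \<and> line_form m x \<noteq> 0" if "l \<in> L i" "m \<in> L i" "l \<noteq> m" for l m
      using pg_lines_not_subset[of l m] line_form(2) component_line[OF assms(1)] that by blast
  qed (use assms component_line line_form line_form_not_zero in blast)+
  then obtain a where a: "\<And>X. ?H X = a * component_form i X"
    unfolding component_form_def by blast
  hence eq: "component_form h X = a * component_form i X + b * component_form j X" for X
    by (metis diff_add_cancel)
  have nonempty: "L i \<noteq> {}" "L j \<noteq> {}" using order card_component assms by fastforce+
  then obtain l m where "l \<in> L i" "m \<in> L j" by blast
  \<comment> \<open>Off the net one form can vanish without the others, which excludes a zero
    coefficient.\<close>
  obtain p where p: "component_form i p = 0" "component_form h p \<noteq> 0"
    using exists_non_net_point[OF assms(1) \<open>l \<in> L i\<close>] assms by metis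
  hence "b \<noteq> 0" using eq[of p] by auto
  obtain p where p: "component_form j p = 0" "component_form h p \<noteq> 0"
    using exists_non_net_point[OF assms(2) \<open>m \<in> L j\<close>] assms by metis
  hence "a \<noteq> 0" using eq[of p] by auto
  show ?thesis using \<open>a \<noteq> 0\<close> \<open>b \<noteq> 0\<close> eq by blast
qed

section \<open>Linear terms at the points of the net\<close>

text \<open>Only the factor of \<open>l\<close> lacks a constant term, so the coefficient of degree
  1 is its slope times the constant terms of the other factors.\<close>

lemma component_form_linear_term:
  assumes i: "i \<in> {1..k}" and l: "l \<in> L i" "p \<in> l" and unique: "\<And>m. m \<in> L i \<Longrightarrow> p \<in> m \<Longrightarrow> m = l"
  shows "coeff (\<Prod>m\<in>L i. [:line_form m p, line_form m v:]) 1 = cofactor i p * line_form l v"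
proof -
  note lf = line_form(2)[OF component_line[OF i]]
  have "line_form m p = 0 \<longleftrightarrow> m = l" if "m \<in> L i" for m
    using lf[OF that, of p] unique[OF that] l by blast
  hence "{m \<in> L i. line_form m p \<noteq> 0} = L i - {l}" by blast
  hence cof: "cofactor i p = (\<Prod>m\<in>L i - {l}. line_form m p)" by (simp add: cofactor_def)
  have "(\<Prod>m\<in>L i. [:line_form m p, line_form m v:]) =
      [:0, line_form l v:] * (\<Prod>m\<in>L i - {l}. [:line_form m p, line_form m v:])"
    using prod.remove[OF finite_component[OF i] l(1), of "\<lambda>m. [:line_form m p, line_form m v:]"]
      lf[OF l(1), of p] l(2) by simp
  moreover have "coeff (\<Prod>m\<in>L i - {l}. [:line_form m p, line_form m v:]) 0 = cofactor i p"
    by (simp add: cof poly_0_coeff_0[symmetric] poly_prod)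
  ultimately show ?thesis by simp
qed

text \<open>The linear term of the pencil relation at a point of the net.\<close>

lemma tangent_pencil:
  assumes ijh: "i \<in> {1..k}" "j \<in> {1..k}" "h \<in> {1..k}" "i \<noteq> j"
    and p: "l \<in> L i" "m \<in> L j" "t \<in> L h" "p \<in> l" "p \<in> m" "p \<in> t" "p \<noteq> 0"
    and pencil: "\<And>X. component_form h X = a * component_form i X + b * component_form j X"
  shows "cofactor h p * line_form t v = a * cofactor i p * line_form l v + b * cofactor j p * line_form m v"
proof -
  define q where "q i = (\<Prod>m\<in>L i. [:line_form m p, line_form m v:])" for i
  have "poly (q s) x = component_form s (p + x *s v)" if "s \<in> {1..k}" for s x
    unfolding q_def component_form_def using line_form(1) component_line that
    by (intro poly_prod_forms) blast
  hence "poly (q h) x = poly (smult a (q i) + smult b (q j)) x" for x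
    using ijh pencil by simp
  hence "q h = smult a (q i) + smult b (q j)"
    by (intro poly_eq_poly_eq_iff[THEN iffD1] ext)
  hence "coeff (q h) 1 = a * coeff (q i) 1 + b * coeff (q j) 1" by simp
  moreover have "coeff (q g) 1 = cofactor g p * line_form s v"
    if "g \<in> {1..k}" "s \<in> L g" "p \<in> s" for g s
    unfolding q_def
    by (rule component_form_linear_term[OF that])
      (use unique_line_through[OF ijh(1,2,4) p(1,2,4,5,7) that(1)] that in blast)
  ultimately show ?thesis using ijh p by (simp add: mult.assoc)
qed

text \<open>For \<open>X\<close> on \<open>l\<close> the term of \<open>l\<close> drops out of
  \<open>tangent_pencil\<close>, so each factor is the ratio at \<open>X\<close> of the forms of two
  lines through \<open>q m\<close>. Their product is the ratio of \<open>component_form h\<close> to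
  \<open>component_form j\<close> at \<open>X\<close>, which the pencil relation shows to be
  \<open>b\<close>.\<close>

lemma prod_tangent_ratios:
  assumes ijh: "i \<in> {1..k}" "j \<in> {1..k}" "h \<in> {1..k}" "i \<noteq> j" "i \<noteq> h" "j \<noteq> h"
    and pencil: "\<And>X. component_form h X = a * component_form i X + b * component_form j X"
    and l: "l \<in> L i" and q: "\<And>m. m \<in> L j \<Longrightarrow> q m \<in> l \<and> q m \<in> m \<and> q m \<noteq> 0"
  shows "(\<Prod>m\<in>L j. b * cofactor j (q m) / cofactor h (q m)) = b"
proof -
  let ?s = "\<lambda>m. line_through h (q m)"
  have bij: "bij_betw ?s (L j) (L h)"
    using bij_betw_line_through[OF ijh(1-5) l q] .
  obtain X where X: "X \<in> l" "component_form j X \<noteq> 0"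
    using exists_non_net_point[OF ijh(1) l] ijh by metis
  have lX: "line_form l X = 0" using X l ijh component_line line_form(2) by blast
  have "line_form (?s m) X = b * cofactor j (q m) / cofactor h (q m) * line_form m X" if m: "m \<in> L j" for m
  proof -
    have "?s m \<in> L h" "q m \<in> ?s m"
      using line_through(1,2)[OF ijh(1,2,4) l m _ _ _ ijh(3)] q[OF m] by simp_all
    hence "cofactor h (q m) * line_form (?s m) X
        = a * cofactor i (q m) * line_form l X + b * cofactor j (q m) * line_form m X"
      using tangent_pencil[OF ijh(1-4) l m _ _ _ _ _ pencil] q[OF m] by blast
    thus ?thesis using lX cofactor_nonzero[OF ijh(3)] by (simp add: field_simps)
  qed
  hence "(\<Prod>m\<in>L j. line_form (?s m) X) =
      (\<Prod>m\<in>L j. b * cofactor j (q m) / cofactor h (q m)) * component_form j X"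
    unfolding component_form_def prod.distrib[symmetric] by (rule prod.cong[OF refl])
  moreover have "(\<Prod>m\<in>L j. line_form (?s m) X) = component_form h X"
    unfolding component_form_def by (rule prod.reindex_bij_betw[OF bij])
  moreover have "component_form h X = b * component_form j X"
    using pencil[of X] component_form_zero[OF ijh(1) l X(1)] by simp
  ultimately show ?thesis using X by simp
qed

text \<open>Multiplies \<open>prod_tangent_ratios\<close> over all lines of one component: the
  coefficient occurs once per point of the net, hence \<open>n * n\<close> times, against
  \<open>n\<close> times on the other side. The cofactors are collected in \<open>C\<close>, taken
  at the same representatives in both equations.\<close>

lemma pencil_coefficient_power:
  assumes ijh: "i \<in> {1..k}" "j \<in> {1..k}" "h \<in> {1..k}" "i \<noteq> j" "i \<noteq> h" "j \<noteq> h"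
    and pencil: "\<And>X. component_form h X = a * component_form i X + b * component_form j X"
    and q: "\<And>l m. l \<in> L i \<Longrightarrow> m \<in> L j \<Longrightarrow> q l m \<in> l \<and> q l m \<in> m \<and> q l m \<noteq> 0"
  defines "C \<equiv> \<lambda>g. \<Prod>l\<in>L i. \<Prod>m\<in>L j. cofactor g (q l m)"
  shows "b ^ (n * n) * C j = b ^ n * C h" "a ^ (n * n) * C i = a ^ n * C h"
proof -
  have nz: "C h \<noteq> 0" unfolding C_def
    using cofactor_nonzero[OF ijh(3)] finite_component ijh by simp
  have fac: "(\<Prod>l\<in>L i. \<Prod>m\<in>L j. c * cofactor g (q l m) / cofactor h (q l m))
      = c ^ (n * n) * C g / C h" for c g
    using ijh by (simp add: C_def prod.distrib prod_dividef card_component power_mult)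
  have "(\<Prod>l\<in>L i. \<Prod>m\<in>L j. b * cofactor j (q l m) / cofactor h (q l m)) = (\<Prod>l\<in>L i. b)"
    using prod_tangent_ratios[OF ijh pencil] q by (intro prod.cong) auto
  thus "b ^ (n * n) * C j = b ^ n * C h"
    unfolding fac using nz ijh by (simp add: card_component field_simps)
  \<comment> \<open>Exchanging \<open>i\<close> and \<open>j\<close> gives the second equation, with
    the lines of component \<open>j\<close> as base lines.\<close>
  have pencil': "component_form h X = b * component_form j X + a * component_form i X" for X
    by (simp add: pencil)
  have "(\<Prod>m\<in>L j. \<Prod>l\<in>L i. a * cofactor i (q l m) / cofactor h (q l m)) = (\<Prod>m\<in>L j. a)"
    using prod_tangent_ratios[OF ijh(2) ijh(1) ijh(3) _ ijh(6) ijh(5) pencil', of _ "\<lambda>l. q l _"] ijh(4) q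
    by (intro prod.cong) auto
  hence "(\<Prod>l\<in>L i. \<Prod>m\<in>L j. a * cofactor i (q l m) / cofactor h (q l m)) = a ^ n"
    using ijh by (subst prod.swap) (simp add: card_component)
  thus "a ^ (n * n) * C i = a ^ n * C h"
    unfolding fac using nz ijh by (simp add: field_simps)
qed

text \<open>With \<open>N = n * n - n\<close>, both \<open>(c * b) ^ N * C i * C j\<close> and
  \<open>(a * d) ^ N * C i * C j\<close> equal \<open>C g * C h\<close>, and the nonzero cofactor
  products cancel.\<close>

lemma pencil_ratio_power:
  assumes ijh: "i \<in> {1..k}" "j \<in> {1..k}" "h \<in> {1..k}" "g \<in> {1..k}" "i \<noteq> j" "i \<noteq> h" "j \<noteq> h" "i \<noteq> g" "j \<noteq> g"
    and h: "\<And>X. component_form h X = a * component_form i X + b * component_form j X"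
    and g: "\<And>X. component_form g X = c * component_form i X + d * component_form j X"
    and nz: "a \<noteq> 0" "b \<noteq> 0" "c \<noteq> 0" "d \<noteq> 0"
  shows "(c * b / (a * d)) ^ (n * n - n) = 1"
proof -
  have "\<exists>p. p \<in> l \<and> p \<in> m \<and> p \<noteq> 0" if "l \<in> L i" "m \<in> L j" for l m
    using pg_lines_meet component_line ijh that by metis
  then obtain q where q: "\<And>l m. l \<in> L i \<Longrightarrow> m \<in> L j \<Longrightarrow> q l m \<in> l \<and> q l m \<in> m \<and> q l m \<noteq> 0"
    by metis
  define C where "C g = (\<Prod>l\<in>L i. \<Prod>m\<in>L j. cofactor g (q l m))" for g
  have Cnz: "C s \<noteq> 0" if "s \<in> {1..k}" for s
    unfolding C_def using cofactor_nonzero that finite_component ijh by simp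
  have "n \<le> n * n" using order by simp
  hence red: "x ^ (n * n - n) * C s = C t" if "x ^ (n * n) * C s = x ^ n * C t" "x \<noteq> 0" for x s t
    using that by (simp add: power_diff field_simps)
  let ?N = "n * n - n"
  have "b ^ ?N * C j = C h" "a ^ ?N * C i = C h" "d ^ ?N * C j = C g" "c ^ ?N * C i = C g"
    using pencil_coefficient_power[OF ijh(1,2,3,5,6,7) h q] nz
      pencil_coefficient_power[OF ijh(1,2,4,5,8,9) g q] unfolding C_def[symmetric] by (blast intro: red)+
  hence "(c ^ ?N * C i) * (b ^ ?N * C j) = (a ^ ?N * C i) * (d ^ ?N * C j)" by simp
  hence "(c ^ ?N * b ^ ?N) * (C i * C j) = (a ^ ?N * d ^ ?N) * (C i * C j)" by (simp only: ac_simps)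
  hence "c ^ ?N * b ^ ?N = a ^ ?N * d ^ ?N" using Cnz ijh by simp
  thus ?thesis using nz by (simp add: power_divide power_mult_distrib)
qed

end

section \<open>Complementary roots of unity\<close>

text \<open>Evaluates one rational polynomial both in the given field and in the complex numbers, so
  that algebraic relations transfer between them.\<close>

definition rat_eval :: "rat poly \<Rightarrow> 'a::field_char_0 \<Rightarrow> 'a" where
  "rat_eval p x = poly (map_poly of_rat p) x"

lemma rat_eval_pCons [simp]: "rat_eval (pCons a p) x = of_rat a + x * rat_eval p x"
  by (simp add: rat_eval_def map_poly_pCons)

lemma rat_eval_0 [simp]: "rat_eval 0 x = 0"
  by (simp add: rat_eval_def)

lemma rat_eval_1 [simp]: "rat_eval 1 x = 1"
  by (simp add: rat_eval_def)

lemma rat_eval_add [simp]: "rat_eval (p + q) x = rat_eval p x + rat_eval q x"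
proof -
  have "map_poly of_rat (p + q) = map_poly of_rat p + (map_poly of_rat q :: 'a poly)"
    by (intro poly_eqI) (simp add: coeff_map_poly of_rat_add)
  thus ?thesis by (simp add: rat_eval_def)
qed

lemma rat_eval_smult [simp]: "rat_eval (smult c p) x = of_rat c * rat_eval p x"
  by (induction p) (auto simp: of_rat_mult algebra_simps)

lemma rat_eval_diff [simp]: "rat_eval (p - q) x = rat_eval p x - rat_eval q x"
  using rat_eval_add[of "p - q" q x] by simp

lemma rat_eval_mult [simp]: "rat_eval (p * q) x = rat_eval p x * rat_eval q x"
  by (induction p) (auto simp: algebra_simps)

lemma rat_eval_power [simp]: "rat_eval (p ^ m) x = rat_eval p x ^ m"
  by (induction m) auto

lemma complex_of_real_of_rat: "complex_of_real (of_rat c) = of_rat c"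
  by (cases c) (simp add: of_rat_rat)

text \<open>The unit circles around 0 and 1 meet only in the two primitive sixth roots of
  unity.\<close>

lemma norm_one_complement:
  fixes z :: complex
  assumes "norm z = 1" "norm (1 - z) = 1"
  shows "z ^ 2 - z + 1 = 0" "Im z \<noteq> 0"
proof -
  have "(Re z)\<^sup>2 + (Im z)\<^sup>2 = 1" "(1 - Re z)\<^sup>2 + (Im z)\<^sup>2 = 1"
    using assms by (simp_all add: cmod_def)
  moreover from this have "Re z = 1 / 2" by (simp add: power2_eq_square algebra_simps)
  ultimately have re: "Re z = 1 / 2" and im: "(Im z)\<^sup>2 = 3 / 4" by (simp_all add: power2_eq_square)
  show "z ^ 2 - z + 1 = 0"
    using im by (simp add: complex_eq_iff Re_power2 Im_power2 re) (simp add: power2_eq_square)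
  show "Im z \<noteq> 0" using im by auto
qed

text \<open>A rational polynomial of least degree with root \<open>x\<close> has a complex root \<open>z\<close>, and \<open>z\<close> and \<open>1 - z\<close> are
  again roots of unity, so \<open>z\<close> is a primitive sixth root of unity.\<close>

lemma complementary_roots_of_unity:
  fixes x :: "'a::field_char_0"
  assumes N: "N > 0" and x: "x ^ N = 1" "(1 - x) ^ N = 1"
  shows "x ^ 2 - x + 1 = 0"
proof -
  define P :: "rat poly" where "P = [:0, 1:] ^ N - 1"
  define Q :: "rat poly" where "Q = [:1, -1:] ^ N - 1"
  define S :: "rat poly" where "S = [:1, -1, 1:]"
  have PQ: "rat_eval P x = 0" "rat_eval Q x = 0"
    using x by (simp_all add: P_def Q_def)
  \<comment> \<open>\<open>P\<close> takes the value \<open>2 ^ N - 1\<close> at 2, so it is a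
    nonzero polynomial annihilating \<open>x\<close>.\<close>
  have "(1::rat) < 2 ^ N" using N by (intro one_less_power) auto
  hence "2 ^ N \<noteq> (1::rat)" by (rule less_imp_neq[symmetric])
  hence "poly P 2 \<noteq> 0" by (simp add: P_def)
  hence "P \<noteq> 0" by auto
  define D where "D = arg_min degree (\<lambda>p. p \<noteq> 0 \<and> rat_eval p x = 0)"
  have D: "D \<noteq> 0" "rat_eval D x = 0" 
    using arg_min_natI[of "\<lambda>p. p \<noteq> 0 \<and> rat_eval p x = 0" P degree] \<open>P \<noteq> 0\<close> PQ unfolding D_def by auto
  have minimal: "degree D \<le> degree p" if "p \<noteq> 0" "rat_eval p x = 0" for p
    unfolding D_def by (rule arg_min_nat_le) (use that in auto)
  have dvd: "D dvd p" if p: "rat_eval p x = 0" for p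
  proof -
    have "rat_eval (p mod D) x = 0"
      using p D(2) by (simp add: minus_div_mult_eq_mod[symmetric])
    moreover have "p mod D = 0 \<or> degree (p mod D) < degree D" using degree_mod_less[OF D(1)] by blast
    ultimately have "p mod D = 0" using minimal[of "p mod D"] by (meson not_le)
    thus ?thesis by auto
  qed
  have "degree D \<noteq> 0"
  proof
    assume "degree D = 0"
    then obtain c where "D = [:c:]" by (auto elim: degree_eq_zeroE)
    thus False using D by simp
  qed
  hence "\<not> constant (poly (map_poly of_rat D :: complex poly))"
    by (simp add: constant_degree degree_map_poly)
  then obtain z :: complex where z: "rat_eval D z = 0"
    using fundamental_theorem_of_algebra unfolding rat_eval_def by blast
  have "rat_eval P z = 0" "rat_eval Q z = 0"
    using dvd[OF PQ(1)] dvd[OF PQ(2)] z by (auto elim!: dvdE)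
  hence "z ^ N = 1" "(1 - z) ^ N = 1" by (simp_all add: P_def Q_def)
  hence "norm z = 1" "norm (1 - z) = 1"
    using N power_eq_1_iff[of z N] power_eq_1_iff[of "1 - z" N] by auto
  note z6 = norm_one_complement[OF this]
  have Sz: "rat_eval S z = 0" using z6(1) by (simp add: S_def power2_eq_square algebra_simps)
  \<comment> \<open>The remainder is linear with rational coefficients and vanishes at the non-real
    number \<open>z\<close>, so it is zero.\<close>
  have "degree (D mod S) < 2" using degree_mod_less[of S D] by (auto simp: S_def)
  moreover obtain c r where cr: "D mod S = pCons c r" by (cases "D mod S")
  ultimately have "degree r = 0" by (cases "r = 0") auto
  then obtain d where "r = [:d:]" by (elim degree_eq_zeroE)
  with cr have cd: "D mod S = [:c, d:]" by simp
  have "rat_eval (D mod S) z = 0"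
    using z Sz by (simp add: minus_div_mult_eq_mod[symmetric])
  hence "of_rat c + z * of_rat d = 0" by (simp add: cd)
  hence "complex_of_real (of_rat c) + z * complex_of_real (of_rat d) = 0"
    by (simp add: complex_of_real_of_rat)
  hence "of_rat c + Re z * of_rat d = 0" "Im z * of_rat d = 0"
    by (simp_all add: complex_eq_iff)
  hence "c = 0" "d = 0" using z6(2) by simp_all
  hence "S dvd D" using cd by (simp add: dvd_eq_mod_eq_0)
  then obtain q where q: "D = S * q" by (elim dvdE)
  have "q \<noteq> 0" using q D by auto
  hence "degree D = degree S + degree q"
    unfolding q by (intro degree_mult_eq) (simp_all add: S_def)
  \<comment> \<open>By minimality of \<open>D\<close> the cofactor \<open>q\<close> does not vanish
    at \<open>x\<close>, which leaves \<open>S\<close> to do so.\<close>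
  hence "degree q < degree D" by (simp add: S_def)
  hence "rat_eval q x \<noteq> 0" using minimal[of q] \<open>q \<noteq> 0\<close> by auto
  hence "rat_eval S x = 0" using D(2) by (simp add: q)
  thus ?thesis by (simp add: S_def power2_eq_square algebra_simps)
qed

section \<open>The cross-ratio of a 4-net\<close>

lemma cross_ratio_eq:
  fixes l1 l2 :: "('a::field ^ 3) set"
  assumes lin: "linear_form r" "linear_form w" and \<kappa>: "\<kappa> \<noteq> 0" "\<kappa> \<noteq> 1"
    and l: "l1 = {x. r x = 0}" "l2 = {x. w x = 0}" "l3 = {x. r x + w x = 0}" "l4 = {x. \<kappa> * r x + w x = 0}"
    and x: "x \<in> l1" "x \<notin> l2" and y: "y \<in> l2" "y \<notin> l1"
  shows "cross_ratio l1 l2 l3 l4 = \<kappa>"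
  unfolding cross_ratio_def
proof (rule the_equality)
  show "\<kappa> \<notin> {0, 1} \<and> (\<exists>r w. linear_form r \<and> linear_form w \<and> l1 = {x. r x = 0} \<and> l2 = {x. w x = 0} \<and>
      l3 = {x. r x + w x = 0} \<and> l4 = {x. \<kappa> * r x + w x = 0})"
    using assms by blast
next
  fix \<kappa>'
  assume "\<kappa>' \<notin> {0, 1} \<and> (\<exists>r w. linear_form r \<and> linear_form w \<and> l1 = {x. r x = 0} \<and> l2 = {x. w x = 0} \<and>
      l3 = {x. r x + w x = 0} \<and> l4 = {x. \<kappa>' * r x + w x = 0})"
  then obtain r' w' where lin': "linear_form r'" "linear_form w'"
    and l': "l1 = {x. r' x = 0}" "l2 = {x. w' x = 0}" "l3 = {x. r' x + w' x = 0}" "l4 = {x. \<kappa>' * r' x + w' x = 0}"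
    by blast
  have vals: "r x = 0" "r' x = 0" "w x \<noteq> 0" "w' x \<noteq> 0" "w y = 0" "w' y = 0" "r y \<noteq> 0" "r' y \<noteq> 0"
    using x y l(1,2) l'(1,2) by auto
  \<comment> \<open>Combinations of \<open>x\<close> and \<open>y\<close> chosen to lie on
    \<open>l3\<close> and \<open>l4\<close>; evaluating the second pair of forms at them compares
    the two parameters.\<close>
  have "r y *s x - w x *s y \<in> l3"
    unfolding l(3) using vals lin by (simp add: linear_form_simps)
  hence 3: "w x * r' y = r y * w' x"
    unfolding l'(3) using vals lin' by (simp add: linear_form_simps)
  have "(\<kappa> * r y) *s x - w x *s y \<in> l4"
    unfolding l(4) using vals lin by (simp add: linear_form_simps)
  hence "\<kappa>' * (w x * r' y) = \<kappa> * (r y * w' x)"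
    unfolding l'(4) using vals lin' by (simp add: linear_form_simps ac_simps)
  thus "\<kappa>' = \<kappa>" using 3 vals by simp
qed

text \<open>The cofactors at \<open>p\<close> are absorbed into the forms \<open>r\<close> and
  \<open>w\<close>, so the cross-ratio depends only on the coefficients of the two pencil relations.
  This makes it the same at all points.\<close>

lemma (in embedded_net) four_net_cross_ratio:
  assumes k: "k = 4"
  obtains \<kappa> where "\<kappa>\<^sup>2 - \<kappa> + 1 = 0"
    "\<And>p l1 l2 l3 l4. p \<noteq> 0 \<Longrightarrow> l1 \<in> L 1 \<Longrightarrow> l2 \<in> L 2 \<Longrightarrow> l3 \<in> L 3 \<Longrightarrow> l4 \<in> L 4 \<Longrightarrow>
       p \<in> l1 \<Longrightarrow> p \<in> l2 \<Longrightarrow> p \<in> l3 \<Longrightarrow> p \<in> l4 \<Longrightarrow> cross_ratio l1 l2 l3 l4 = \<kappa>"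
proof -
  have I: "1 \<in> {1..k}" "2 \<in> {1..k}" "3 \<in> {1..k}" "4 \<in> {1..k}" using k by auto
  obtain a b where F3: "\<And>X. component_form 3 X = a * component_form 1 X + b * component_form 2 X"
    and ab: "a \<noteq> 0" "b \<noteq> 0"
    using component_form_pencil[OF I(1,2,3)] by auto
  obtain c d where F4: "\<And>X. component_form 4 X = c * component_form 1 X + d * component_form 2 X"
    and cd: "c \<noteq> 0" "d \<noteq> 0"
    using component_form_pencil[OF I(1,2,4)] by auto
  \<comment> \<open>Rescaling the first two terms so that \<open>l3\<close> becomes
    \<open>r + w = 0\<close> turns the equation of \<open>l4\<close> into
    \<open>(c / a) * r + (d / b) * w = 0\<close>; dividing by \<open>d / b\<close> gives this
    value.\<close>
  define \<kappa> where "\<kappa> = c * b / (a * d)"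
  define N where "N = n * n - n"
  have "N > 0" using order by (simp add: N_def)
  \<comment> \<open>Equality would make \<open>component_form 4\<close> proportional to
    \<open>component_form 3\<close>, which vanishes at a point where the other does not.\<close>
  have "c * b \<noteq> a * d"
  proof
    assume eq: "c * b = a * d"
    have "4 \<noteq> (3::nat)" by simp
    have "L 3 \<noteq> {}" using card_component[OF I(3)] order by auto
    then obtain l where "l \<in> L 3" by blast
    obtain p where p: "component_form 3 p = 0" "component_form 4 p \<noteq> 0"
      using exists_non_net_point[OF I(3) \<open>l \<in> L 3\<close>] I(4) \<open>4 \<noteq> (3::nat)\<close> by metis
    have "a * component_form 4 p = c * component_form 3 p"
      unfolding F3 F4 using eq by (simp add: algebra_simps)
    thus False using p ab by simp
  qed
  hence \<kappa>: "\<kappa> \<noteq> 0" "\<kappa> \<noteq> 1" using ab cd by (auto simp: \<kappa>_def)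
  have "\<kappa> ^ N = 1"
    unfolding \<kappa>_def N_def
    using pencil_ratio_power[OF I(1,2,3,4) _ _ _ _ _ F3 F4 ab cd] by simp
  moreover have "(1 - \<kappa>) ^ N = 1"
  proof -
    \<comment> \<open>Components 2 and 3 change places: solve for \<open>component_form 2\<close>
      and substitute in the relation for component 4.\<close>
    have F2: "component_form 2 X = (- a / b) * component_form 1 X + (1 / b) * component_form 3 X" for X
      unfolding F3 using ab by (simp add: field_simps)
    have F4': "component_form 4 X = (c - d * a / b) * component_form 1 X + (d / b) * component_form 3 X" for X
      unfolding F3 F4 using ab by (simp add: field_simps)
    have nz: "c - d * a / b \<noteq> 0" using \<open>c * b \<noteq> a * d\<close> ab by (simp add: field_simps)
    have "((c - d * a / b) * (1 / b) / ((- a / b) * (d / b))) ^ N = 1"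
      unfolding N_def
      using pencil_ratio_power[OF I(1,3,2,4) _ _ _ _ _ F2 F4' _ _ nz] ab cd by simp
    moreover have "(c - d * a / b) * (1 / b) / ((- a / b) * (d / b)) = 1 - \<kappa>"
      using ab cd by (simp add: \<kappa>_def field_simps)
    ultimately show ?thesis by simp
  qed
  ultimately have \<kappa>6: "\<kappa>\<^sup>2 - \<kappa> + 1 = 0"
    using complementary_roots_of_unity \<open>N > 0\<close> by blast
  have "cross_ratio l1 l2 l3 l4 = \<kappa>"
    if p: "p \<noteq> 0" and l: "l1 \<in> L 1" "l2 \<in> L 2" "l3 \<in> L 3" "l4 \<in> L 4"
      and pl: "p \<in> l1" "p \<in> l2" "p \<in> l3" "p \<in> l4" for p l1 l2 l3 l4
  proof -
    note lines = component_line[OF I(1) l(1)] component_line[OF I(2) l(2)]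
      component_line[OF I(3) l(3)] component_line[OF I(4) l(4)]
    have "l1 \<noteq> l2" using component_lines_distinct[OF I(1,2) _ l(1,2)] by simp
    then obtain x y where xy: "x \<in> l1" "x \<notin> l2" "y \<in> l2" "y \<notin> l1"
      using pg_lines_not_subset[OF lines(1,2)] pg_lines_not_subset[OF lines(2,1)] by blast
    define r where "r v = a * cofactor 1 p * line_form l1 v" for v
    define w where "w v = b * cofactor 2 p * line_form l2 v" for v
    have nz: "cofactor 1 p \<noteq> 0" "cofactor 2 p \<noteq> 0" "cofactor 3 p \<noteq> 0" "cofactor 4 p \<noteq> 0"
      using cofactor_nonzero I by blast+
    have lin: "linear_form r" "linear_form w"
      unfolding r_def[abs_def] w_def[abs_def] using lines line_form(1) by (auto intro: linear_form_mult)
    have t3: "cofactor 3 p * line_form l3 v = r v + w v" for v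
      using tangent_pencil[OF I(1,2,3) _ l(1,2,3) pl(1,2,3) p F3] by (simp add: r_def w_def)
    have "cofactor 4 p * line_form l4 v = c * cofactor 1 p * line_form l1 v + d * cofactor 2 p * line_form l2 v" for v
      using tangent_pencil[OF I(1,2,4) _ l(1,2,4) pl(1,2,4) p F4] by simp
    hence t4: "b * cofactor 4 p * line_form l4 v = d * (\<kappa> * r v + w v)" for v
      using ab cd by (simp add: \<kappa>_def r_def w_def field_simps)
    have "l1 = {x. r x = 0}" "l2 = {x. w x = 0}"
      using line_form(2) lines ab nz by (auto simp: r_def w_def)
    moreover have "l3 = {x. r x + w x = 0}"
      using line_form(2)[OF lines(3)] nz by (auto simp: t3[symmetric])
    moreover have "\<kappa> * r v + w v = 0 \<longleftrightarrow> line_form l4 v = 0" for v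
      using t4[of v] ab cd nz by (metis mult_eq_0_iff)
    hence "l4 = {x. \<kappa> * r x + w x = 0}"
      using line_form(2)[OF lines(4)] by blast
    ultimately show ?thesis
      using cross_ratio_eq[OF lin \<kappa> _ _ _ _ xy] by blast
  qed
  thus ?thesis using that \<kappa>6 by blast
qed

theorem theorem4p2:
  fixes L :: "nat \<Rightarrow> ('a::field_char_0 ^ 3) set set" and n :: nat
  assumes "is_net 4 n L"
    and "n \<ge> 2"
  shows "(\<exists>s::'a. s ^ 2 = -3) \<and>
    (constant_cross_ratio L) ^ 2 - constant_cross_ratio L + 1 = 0"
proof -
  interpret embedded_net 4 n L by unfold_locales fact+
  obtain \<kappa> where \<kappa>: "\<kappa>\<^sup>2 - \<kappa> + 1 = 0"
    and cr: "\<And>p l1 l2 l3 l4. p \<noteq> 0 \<Longrightarrow> l1 \<in> L 1 \<Longrightarrow> l2 \<in> L 2 \<Longrightarrow> l3 \<in> L 3 \<Longrightarrow> l4 \<in> L 4 \<Longrightarrow>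
       p \<in> l1 \<Longrightarrow> p \<in> l2 \<Longrightarrow> p \<in> l3 \<Longrightarrow> p \<in> l4 \<Longrightarrow> cross_ratio l1 l2 l3 l4 = \<kappa>"
    using four_net_cross_ratio by blast
  have "constant_cross_ratio L = \<kappa>"
    unfolding constant_cross_ratio_def
  proof (rule the_equality; (intro ballI impI)?)
    fix P l1 l2 l3 l4
    assume P: "P \<in> net_points 4 L" and l: "l1 \<in> L 1" "l2 \<in> L 2" "l3 \<in> L 3" "l4 \<in> L 4"
      and sub: "P \<subseteq> l1 \<and> P \<subseteq> l2 \<and> P \<subseteq> l3 \<and> P \<subseteq> l4"
    from P obtain i j l m where lm: "i \<in> {1..4}" "j \<in> {1..4}" "l \<in> L i" "m \<in> L j" "P = l \<inter> m"
      unfolding net_points_def by blast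
    then obtain p where "p \<noteq> 0" "p \<in> P"
      using pg_lines_meet[OF component_line[OF lm(1,3)] component_line[OF lm(2,4)]] by blast
    thus "cross_ratio l1 l2 l3 l4 = \<kappa>" using cr l sub by blast
  next
    fix \<kappa>'
    assume *: "\<forall>P\<in>net_points 4 L. \<forall>l1\<in>L 1. \<forall>l2\<in>L 2. \<forall>l3\<in>L 3. \<forall>l4\<in>L 4.
      P \<subseteq> l1 \<and> P \<subseteq> l2 \<and> P \<subseteq> l3 \<and> P \<subseteq> l4 \<longrightarrow> cross_ratio l1 l2 l3 l4 = \<kappa>'"
    \<comment> \<open>The net has a point, so the condition on \<open>\<kappa>'\<close> is not
      vacuous and one cross-ratio determines it.\<close>
    have I: "1 \<in> {1..4::nat}" "2 \<in> {1..4::nat}" "3 \<in> {1..4::nat}" "4 \<in> {1..4::nat}" by auto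
    have "L 1 \<noteq> {}" "L 2 \<noteq> {}"
      using card_component[OF I(1)] card_component[OF I(2)] order by auto
    then obtain l m where l: "l \<in> L 1" and m: "m \<in> L 2" by blast
    note lines = component_line[OF I(1) l] component_line[OF I(2) m]
    obtain p where p: "p \<noteq> 0" "p \<in> l" "p \<in> m" using pg_lines_meet[OF lines] by blast
    let ?t = "\<lambda>h. line_through h p"
    have t: "?t h \<in> L h" "p \<in> ?t h" if "h \<in> {1..4}" for h
      using line_through(1,2)[OF I(1,2) _ l m p(2,3,1) that] by simp_all
    have "l \<noteq> m" using component_lines_distinct[OF I(1,2) _ l m] by simp
    hence sub: "l \<inter> m \<subseteq> ?t h" if "h \<in> {1..4}" for h
      using pg_lines_meet_unique[OF lines _ p(2,3,1) component_line[OF that t(1)[OF that]] t(2)[OF that]] by blast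
    have "l \<inter> m \<in> net_points 4 L"
      unfolding net_points_def mem_Collect_eq using l m
      by (intro exI[of _ l] exI[of _ m] exI[of _ 1] exI[of _ 2]) simp
    hence "cross_ratio (?t 1) (?t 2) (?t 3) (?t 4) = \<kappa>'"
      using *[rule_format, OF _ t(1)[OF I(1)] t(1)[OF I(2)] t(1)[OF I(3)] t(1)[OF I(4)]]
        sub[OF I(1)] sub[OF I(2)] sub[OF I(3)] sub[OF I(4)] by blast
    moreover have "cross_ratio (?t 1) (?t 2) (?t 3) (?t 4) = \<kappa>"
      by (rule cr[OF p(1) t(1)[OF I(1)] t(1)[OF I(2)] t(1)[OF I(3)] t(1)[OF I(4)]
        t(2)[OF I(1)] t(2)[OF I(2)] t(2)[OF I(3)] t(2)[OF I(4)]])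
    ultimately show "\<kappa>' = \<kappa>" by simp
  qed
  moreover have "(2 * \<kappa> - 1)\<^sup>2 = 4 * (\<kappa>\<^sup>2 - \<kappa> + 1) - 3"
    by (simp add: power2_eq_square algebra_simps)
  hence "(2 * \<kappa> - 1)\<^sup>2 = -3" using \<kappa> by simp
  ultimately show ?thesis using \<kappa> by blast
qed

end
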